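(* Let $(S,A,r,P,\mu_0,H)$ be a finite-horizon mean-field game satisfying Assumptions 1 (weak monotonicity), 2 (transition kernel independent of the state measure) and 3 (Lipschitz reward with constant $L_r>0$) stated in the context. Let $L=|S||A|L_r$, let $\gamma\ge 2$, let $\rho^0\in\mathcal K$, and let $(\rho^k)_{k\ge0}$ be generated by $$\rho^{k+1}=\Pi_{\mathcal K}\big((1-\beta_k)\rho^k+\beta_k\rho^0-\alpha_kF(\rho^k)\big),\quad k=0,1,2,\dots,\qquad \alpha_k=\frac{1}{L\sqrt{k+\gamma}},\quad \beta_k=\frac{\gamma}{k+\gamma}.$$ Then for every $T\ge 1$, $$r^{\mathrm{tan}}_{F,N_{\mathcal K}}(\rho^T)\le\frac{25\,\gamma\,\sqrt{2H}\,|S|\,|A|\,L_r}{\sqrt{T-1+\gamma}}.$$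
   Context: Mean-field game: $S$ and $A$ are finite nonempty sets, $H\ge 1$ an integer, $\mathcal P(S)$ the set of probability measures on $S$, $\mu_0\in\mathcal P(S)$ the initial distribution, $r:S\times A\times\mathcal P(S)\to\mathbb R$ the reward, $P:S\times A\times\mathcal P(S)\to\mathcal P(S)$ the transition kernel. A policy flow is $\pi=(\pi_h)_{h=0}^{H-1}$ with $\pi_h(\cdot\mid s)\in\mathcal P(A)$ for each $s\in S$. Assumption 2: $P(\cdot\mid s,a,\mu)=P(\cdot\mid s,a)$ for all $\mu\in\mathcal P(S)$. Given a policy flow $\pi$, its state flow is $\mu^\pi_0=\mu_0$, $\mu^\pi_{h+1}(s')=\sum_{s,a}P(s'\mid s,a)\pi_h(a\mid s)\mu^\pi_h(s)$, and its occupation flow is $\rho^\pi_h(s,a)=\pi_h(a\mid s)\mu^\pi_h(s)$. Assumption 1 (weak monotonicity): for all policy flows $\pi,\tilde\pi$, $\sum_{h=0}^{H-1}\sum_{s,a}\big(r(s,a,\mu^\pi_h)-r(s,a,\mu^{\tilde\pi}_h)\big)\big(\rho^\pi_h(s,a)-\rho^{\tilde\pi}_h(s,a)\big)\le 0$. Assumption 3: $|r(s,a,\mu)-r(s,a,\tilde\mu)|\le L_r\|\mu-\tilde\mu\|_{\mathrm{TV}}$ for all $(s,a)$ and $\mu,\tilde\mu\in\mathcal P(S)$, where $\|\mu-\tilde\mu\|_{\mathrm{TV}}=\sum_{s}|\mu(s)-\tilde\mu(s)|$. Occupation-flow polytope: $\mathcal K$ is the set of $\rho=(\rho_h)_{h=0}^{H-1}\in\prod_{h=0}^{H-1}\mathbb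 R_+^{S\times A}$ with $\sum_a\rho_0(s,a)=\mu_0(s)$ for all $s$, and $\sum_a\rho_{h+1}(s',a)=\sum_{s,a}P(s'\mid s,a)\rho_h(s,a)$ for all $s'\in S$, $h=0,\dots,H-2$. For $\rho\in\mathcal K$ put $\mu^\rho_h(s)=\sum_a\rho_h(s,a)$. The operator $F:\mathcal K\to\mathbb R^{H|S||A|}$ is $[F(\rho)]_{h,s,a}=-r(s,a,\mu^\rho_h)$. $\Pi_{\mathcal K}$ is the Euclidean projection onto $\mathcal K$. For $x\in\mathcal K$, $N_{\mathcal K}(x)=\{g\in\mathbb R^{H|S||A|}:\langle g,y-x\rangle\le 0\ \forall y\in\mathcal K\}$. The tangential residual is $r^{\mathrm{tan}}_{F,N_{\mathcal K}}(\rho)=\inf_{c\in N_{\mathcal K}(\rho)}\|F(\rho)+c\|_2$ for $\rho\in\mathcal K$. *)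

theory Defs
  imports "HOL-Analysis.Analysis"
begin

text \<open>
  The state space \<open>S\<close> and the action space \<open>A\<close> are finite types \<open>'s\<close> and \<open>'a\<close>. The horizon is
  \<open>H = CARD('h)\<close> for a finite type \<open>'h\<close> of time steps, so that \<open>real ^ ('h \<times> 's \<times> 'a)\<close>, with its
  library inner product and norm, is the Euclidean space of dimension \<open>H |S| |A|\<close>.
\<close>

text \<open>
  Measures on a finite type are represented by their mass functions. Rewards and kernels
  are total in the measure argument; they are only constrained on probability vectors.
\<close>

definition prob_vec :: "('x::finite \<Rightarrow> real) \<Rightarrow> bool" where
  "prob_vec p \<longleftrightarrow> (\<forall>x. 0 \<le> p x) \<and> (\<Sum>x\<in>UNIV. p x) = 1"

text \<open>Without the customary factor 1/2.\<close>

definition tv_norm :: "('s::finite \<Rightarrow> real) \<Rightarrow> real" where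
  "tv_norm v = (\<Sum>s\<in>UNIV. \<bar>v s\<bar>)"

text \<open>\<open>P s a \<mu> s'\<close> is the probability of moving to \<open>s'\<close>, written \<open>P(s' | s, a, \<mu>)\<close> on paper.\<close>

definition mean_field_game ::
  "('s::finite \<Rightarrow> real) \<Rightarrow> ('s \<Rightarrow> 'a::finite \<Rightarrow> ('s \<Rightarrow> real) \<Rightarrow> 's \<Rightarrow> real) \<Rightarrow> bool" where
  "mean_field_game \<mu>0 P \<longleftrightarrow>
     prob_vec \<mu>0 \<and> (\<forall>s a \<mu>. prob_vec \<mu> \<longrightarrow> prob_vec (P s a \<mu>))"

text \<open>The kernel \<open>Q\<close> is the common value of \<open>P\<close> over all probability vectors \<open>\<mu>\<close>.\<close>

definition measure_independent_kernel ::
  "('s::finite \<Rightarrow> 'a::finite \<Rightarrow> ('s \<Rightarrow> real) \<Rightarrow> 's \<Rightarrow> real) \<Rightarrow> ('s \<Rightarrow> 'a \<Rightarrow> 's \<Rightarrow> real) \<Rightarrow> bool" where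
  "measure_independent_kernel P Q \<longleftrightarrow> (\<forall>s a \<mu>. prob_vec \<mu> \<longrightarrow> P s a \<mu> = Q s a)"

definition lipschitz_reward ::
  "('s::finite \<Rightarrow> 'a::finite \<Rightarrow> ('s \<Rightarrow> real) \<Rightarrow> real) \<Rightarrow> real \<Rightarrow> bool" where
  "lipschitz_reward r Lr \<longleftrightarrow>
     (\<forall>s a \<mu> \<nu>. prob_vec \<mu> \<longrightarrow> prob_vec \<nu> \<longrightarrow>
        \<bar>r s a \<mu> - r s a \<nu>\<bar> \<le> Lr * tv_norm (\<lambda>x. \<mu> x - \<nu> x))"

definition policy_flow :: "nat \<Rightarrow> (nat \<Rightarrow> 's::finite \<Rightarrow> 'a::finite \<Rightarrow> real) \<Rightarrow> bool" where
  "policy_flow H \<pi> \<longleftrightarrow> (\<forall>h<H. \<forall>s. prob_vec (\<pi> h s))"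

primrec state_flow ::
  "('s::finite \<Rightarrow> real) \<Rightarrow> ('s \<Rightarrow> 'a::finite \<Rightarrow> 's \<Rightarrow> real) \<Rightarrow> (nat \<Rightarrow> 's \<Rightarrow> 'a \<Rightarrow> real)
     \<Rightarrow> nat \<Rightarrow> 's \<Rightarrow> real" where
  "state_flow \<mu>0 Q \<pi> 0 = \<mu>0"
| "state_flow \<mu>0 Q \<pi> (Suc h) =
     (\<lambda>s'. \<Sum>s\<in>UNIV. \<Sum>a\<in>UNIV. Q s a s' * \<pi> h s a * state_flow \<mu>0 Q \<pi> h s)"

definition occupation_flow ::
  "('s::finite \<Rightarrow> real) \<Rightarrow> ('s \<Rightarrow> 'a::finite \<Rightarrow> 's \<Rightarrow> real) \<Rightarrow> (nat \<Rightarrow> 's \<Rightarrow> 'a \<Rightarrow> real)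
     \<Rightarrow> nat \<Rightarrow> 's \<Rightarrow> 'a \<Rightarrow> real" where
  "occupation_flow \<mu>0 Q \<pi> h s a = \<pi> h s a * state_flow \<mu>0 Q \<pi> h s"

definition weakly_monotone ::
  "nat \<Rightarrow> ('s::finite \<Rightarrow> real) \<Rightarrow> ('s \<Rightarrow> 'a::finite \<Rightarrow> 's \<Rightarrow> real)
     \<Rightarrow> ('s \<Rightarrow> 'a \<Rightarrow> ('s \<Rightarrow> real) \<Rightarrow> real) \<Rightarrow> bool" where
  "weakly_monotone H \<mu>0 Q r \<longleftrightarrow>
     (\<forall>\<pi> \<pi>'. policy_flow H \<pi> \<longrightarrow> policy_flow H \<pi>' \<longrightarrow>
        (\<Sum>h<H. \<Sum>s\<in>UNIV. \<Sum>a\<in>UNIV.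
           (r s a (state_flow \<mu>0 Q \<pi> h) - r s a (state_flow \<mu>0 Q \<pi>' h)) *
           (occupation_flow \<mu>0 Q \<pi> h s a - occupation_flow \<mu>0 Q \<pi>' h s a)) \<le> 0)"

text \<open>
  A fixed enumeration of the time steps: \<open>stage 0, \<dots>, stage (CARD('h) - 1)\<close> are the distinct
  elements of \<open>'h\<close>. It is meaningful only for arguments below \<open>CARD('h)\<close>.
\<close>

definition stage :: "nat \<Rightarrow> 'h::finite" where
  "stage = from_nat_into UNIV"

lemma bij_betw_stage: "bij_betw (stage :: nat \<Rightarrow> 'h::finite) {..<CARD('h)} UNIV"
  unfolding stage_def by (rule bij_betw_from_nat_into_finite) simp

definition marginal :: "real ^ ('h::finite \<times> 's::finite \<times> 'a::finite) \<Rightarrow> 'h \<Rightarrow> 's \<Rightarrow> real" where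
  "marginal \<rho> t s = (\<Sum>a\<in>UNIV. \<rho> $ (t, s, a))"

definition occupation_polytope ::
  "('s::finite \<Rightarrow> real) \<Rightarrow> ('s \<Rightarrow> 'a::finite \<Rightarrow> 's \<Rightarrow> real)
     \<Rightarrow> (real ^ ('h::finite \<times> 's \<times> 'a)) set" where
  "occupation_polytope \<mu>0 Q =
     {\<rho>. (\<forall>i. 0 \<le> \<rho> $ i) \<and>
         (\<forall>s. (\<Sum>a\<in>UNIV. \<rho> $ (stage 0, s, a)) = \<mu>0 s) \<and>
         (\<forall>h s'. Suc h < CARD('h) \<longrightarrow>
            (\<Sum>a\<in>UNIV. \<rho> $ (stage (Suc h), s', a)) =
            (\<Sum>s\<in>UNIV. \<Sum>a\<in>UNIV. Q s a s' * \<rho> $ (stage h, s, a)))}"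

definition reward_operator ::
  "('s::finite \<Rightarrow> 'a::finite \<Rightarrow> ('s \<Rightarrow> real) \<Rightarrow> real)
     \<Rightarrow> real ^ ('h::finite \<times> 's \<times> 'a) \<Rightarrow> real ^ ('h \<times> 's \<times> 'a)" where
  "reward_operator r \<rho> = (\<chi> i. case i of (t, s, a) \<Rightarrow> - r s a (marginal \<rho> t))"

definition normal_cone :: "'v::euclidean_space set \<Rightarrow> 'v \<Rightarrow> 'v set" where
  "normal_cone K x = {g. \<forall>y\<in>K. g \<bullet> (y - x) \<le> 0}"

text \<open>The infimum is over a nonempty set bounded below whenever \<open>N x\<close> is nonempty,
  in particular for every normal cone, which contains \<open>0\<close>.\<close>

definition tangential_residual ::
  "('v::euclidean_space \<Rightarrow> 'v) \<Rightarrow> ('v \<Rightarrow> 'v set) \<Rightarrow> 'v \<Rightarrow> real" where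
  "tangential_residual F N x = (INF c\<in>N x. norm (F x + c))"

end

theory Submission
  imports Defs
begin

text \<open>
  On \<open>K\<close> the operator \<open>F\<close> is monotone and \<open>L\<close>-Lipschitz, and \<open>K\<close> has diameter at most
  \<open>D = sqrt (2 H)\<close>. With \<open>n = k + \<gamma>\<close>, the variational inequalities of two consecutive projections
  give the recursion \<open>U\<^sub>k \<le> (1 - 11 / (10 n)) U\<^sub>k\<^sub>-\<^sub>1 + \<gamma> D / (2 n (n - 1))\<close> for the step lengths
  \<open>U\<^sub>k = norm (\<rho>\<^sub>k\<^sub>+\<^sub>1 - \<rho>\<^sub>k)\<close>, hence \<open>U\<^sub>k \<le> 5 \<gamma> D / n\<close>. The projection itself supplies the normal vector
  \<open>c = - F \<rho>\<^sub>k - (\<rho>\<^sub>k\<^sub>+\<^sub>1 - \<rho>\<^sub>k) / \<alpha>\<^sub>k - (\<beta>\<^sub>k / \<alpha>\<^sub>k) (\<rho>\<^sub>k - \<rho>\<^sub>0)\<close> at \<open>\<rho>\<^sub>k\<^sub>+\<^sub>1\<close>, and then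
  \<open>norm (F \<rho>\<^sub>k\<^sub>+\<^sub>1 + c) \<le> (L + 1 / \<alpha>\<^sub>k) U\<^sub>k + (\<beta>\<^sub>k / \<alpha>\<^sub>k) D \<le> 11 \<gamma> L D / sqrt n\<close>.
\<close>

section \<open>Scalar and inner-product estimates for a single step\<close>

text \<open>The sign condition on \<open>d \<bullet> u\<close> makes the cross term of the expanded
  square nonpositive, so only \<open>b\<^sup>2\<close> and \<open>(c * L)\<^sup>2\<close> remain;
  the triangle inequality would give the larger factor \<open>b + c * L\<close>.\<close>

lemma norm_scaled_diff_le:
  fixes u d :: "'v::real_inner"
  assumes "0 \<le> b" "0 \<le> c" "0 \<le> d \<bullet> u" "norm d \<le> L * norm u" "0 \<le> q" "b\<^sup>2 + (c * L)\<^sup>2 \<le> q\<^sup>2"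
  shows "norm (b *\<^sub>R u - c *\<^sub>R d) \<le> q * norm u"
proof (rule power2_le_imp_le)
  have "(norm (b *\<^sub>R u - c *\<^sub>R d))\<^sup>2 = b\<^sup>2 * (norm u)\<^sup>2 + c\<^sup>2 * (norm d)\<^sup>2 - 2 * b * c * (d \<bullet> u)"
    unfolding power2_norm_eq_inner
    by (simp add: inner_diff_left inner_diff_right inner_commute algebra_simps power2_eq_square)
  also have "\<dots> \<le> b\<^sup>2 * (norm u)\<^sup>2 + c\<^sup>2 * (norm d)\<^sup>2"
    using assms(1-3) by simp
  also have "\<dots> \<le> b\<^sup>2 * (norm u)\<^sup>2 + c\<^sup>2 * (L * norm u)\<^sup>2"
    using assms(4) by (intro add_left_mono mult_left_mono power_mono) auto
  also have "\<dots> = (b\<^sup>2 + (c * L)\<^sup>2) * (norm u)\<^sup>2"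
    by (simp add: algebra_simps)
  also have "\<dots> \<le> q\<^sup>2 * (norm u)\<^sup>2"
    using assms(6) by (intro mult_right_mono) auto
  finally show "(norm (b *\<^sub>R u - c *\<^sub>R d))\<^sup>2 \<le> (q * norm u)\<^sup>2"
    by (simp add: power_mult_distrib)
qed (use assms in auto)

text \<open>\<open>a\<close> is the ratio of consecutive step sizes, and \<open>1 / n\<close> the
  squared product of step size and Lipschitz constant. A coefficient above 1 in the bound is what
  later leaves room for the drift of the anchor.\<close>

lemma contraction_factor_le:
  fixes a \<gamma> n :: real
  assumes "2 \<le> \<gamma>" "\<gamma> + 1 \<le> n" "0 \<le> a" "a\<^sup>2 = 1 - 1 / n"
  shows "0 \<le> a - \<gamma> / n" "(a - \<gamma> / n)\<^sup>2 + 1 / n \<le> (1 - 11 / (10 * n))\<^sup>2"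
proof -
  have n: "3 \<le> n" using assms by simp
  have "1 - 1 / n \<le> 1" "0 \<le> 1 - 1 / n" using n by auto
  then have "(1 - 1 / n)\<^sup>2 \<le> a\<^sup>2"
    using assms(4) by (simp add: power2_eq_square mult_left_le)
  then have "1 - 1 / n \<le> a"
    using assms(3) by (rule power2_le_imp_le)
  moreover have "\<gamma> / n \<le> 1 - 1 / n"
    using assms n by (simp add: field_simps)
  ultimately show nonneg: "0 \<le> a - \<gamma> / n" by simp
  \<comment> \<open>The root expands as \<open>1 - 1 / (2 * n)\<close> to first order; 3/5 instead
    of 1/2 absorbs the higher-order terms once \<open>n \<ge> 9 / 5\<close>.\<close>
  have "(1 - 3 / (5 * n))\<^sup>2 \<le> a\<^sup>2"
    using n unfolding assms(4) by (simp add: field_simps power2_eq_square)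
  then have a: "1 - 3 / (5 * n) \<le> a"
    using assms(3) by (rule power2_le_imp_le)
  have "a - \<gamma> / n \<le> a - 2 / n"
    using assms n by (simp add: divide_right_mono)
  then have "(a - \<gamma> / n)\<^sup>2 + 1 / n \<le> (a - 2 / n)\<^sup>2 + 1 / n"
    using nonneg by (simp add: power_mono)
  also have "\<dots> = a\<^sup>2 - 4 / n * a + 4 / n\<^sup>2 + 1 / n"
    by (simp add: power2_diff power_divide)
  also have "\<dots> = 1 - 4 / n * a + 4 / n\<^sup>2"
    by (simp add: assms(4))
  also have "\<dots> \<le> 1 - 4 / n * (1 - 3 / (5 * n)) + 4 / n\<^sup>2"
    using a n by (simp add: mult_left_mono divide_right_mono)
  \<comment> \<open>This reduces to \<open>n \<ge> 173 / 60\<close>, just below the available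
    3.\<close>
  also have "\<dots> \<le> (1 - 11 / (10 * n))\<^sup>2"
    using n by (simp add: field_simps power2_eq_square)
  finally show "(a - \<gamma> / n)\<^sup>2 + 1 / n \<le> (1 - 11 / (10 * n))\<^sup>2" .
qed

text \<open>Since \<open>a\<^sup>2 = (n - 1) / n\<close>, the difference is
  \<open>\<gamma> / (n - 1)\<close> times \<open>a - a\<^sup>2\<close>, and
  \<open>(1 - a)\<^sup>2 \<ge> 0\<close> bounds that factor by \<open>1 / (2 * n)\<close>. The drift
  is thus of second order in \<open>1 / n\<close>.\<close>

lemma anchor_drift_le:
  fixes a \<gamma> n :: real
  assumes "0 \<le> \<gamma>" "1 < n" "0 \<le> a" "a\<^sup>2 = 1 - 1 / n"
  shows "0 \<le> a * (\<gamma> / (n - 1)) - \<gamma> / n"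
    "a * (\<gamma> / (n - 1)) - \<gamma> / n \<le> \<gamma> / (2 * n * (n - 1))"
proof -
  have "a\<^sup>2 = (n - 1) / n" using assms by (simp add: diff_divide_distrib)
  then have "\<gamma> / (n - 1) * a\<^sup>2 = \<gamma> / n" using assms(2) by simp
  then have eq: "a * (\<gamma> / (n - 1)) - \<gamma> / n = \<gamma> / (n - 1) * (a - a\<^sup>2)"
    by (simp add: right_diff_distrib)
  have "a\<^sup>2 \<le> 1\<^sup>2" using assms by simp
  then have a1: "a \<le> 1" by (rule power2_le_imp_le) simp
  then have "0 \<le> a * (1 - a)" using assms by simp
  then have "0 \<le> a - a\<^sup>2" by (simp add: power2_eq_square algebra_simps)
  then show "0 \<le> a * (\<gamma> / (n - 1)) - \<gamma> / n"
    unfolding eq using assms by simp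
  have "0 \<le> (1 - a)\<^sup>2" by simp
  then have "a - a\<^sup>2 \<le> (1 - a\<^sup>2) / 2" by (simp add: power2_eq_square algebra_simps)
  then have "a - a\<^sup>2 \<le> 1 / (2 * n)" using assms by simp
  then have "\<gamma> / (n - 1) * (a - a\<^sup>2) \<le> \<gamma> / (n - 1) * (1 / (2 * n))"
    using assms by (intro mult_left_mono) auto
  then show "a * (\<gamma> / (n - 1)) - \<gamma> / n \<le> \<gamma> / (2 * n * (n - 1))"
    unfolding eq by (simp add: mult_ac)
qed

section \<open>The anchored projection iteration for a monotone Lipschitz operator\<close>

locale anchored_projection =
  fixes K :: "'v::euclidean_space set" and F :: "'v \<Rightarrow> 'v" and L D \<gamma> :: real
    and \<alpha> \<beta> :: "nat \<Rightarrow> real" and x :: "nat \<Rightarrow> 'v"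
  assumes convex: "convex K" and closed: "closed K"
    and monotone: "\<And>y z. y \<in> K \<Longrightarrow> z \<in> K \<Longrightarrow> 0 \<le> (F y - F z) \<bullet> (y - z)"
    and lipschitz: "\<And>y z. y \<in> K \<Longrightarrow> z \<in> K \<Longrightarrow> norm (F y - F z) \<le> L * norm (y - z)"
    and diameter: "\<And>y z. y \<in> K \<Longrightarrow> z \<in> K \<Longrightarrow> norm (y - z) \<le> D"
    and L_pos: "0 < L" and gamma_ge: "2 \<le> \<gamma>"
    and alpha: "\<And>k. \<alpha> k = 1 / (L * sqrt (real k + \<gamma>))"
    and beta: "\<And>k. \<beta> k = \<gamma> / (real k + \<gamma>)"
    and start: "x 0 \<in> K"
    and step: "\<And>k. x (Suc k) =
      closest_point K ((1 - \<beta> k) *\<^sub>R x k + \<beta> k *\<^sub>R x 0 - \<alpha> k *\<^sub>R F (x k))"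
begin

lemma iterate_in: "x k \<in> K"
  using start closed by (cases k) (auto simp: step intro!: closest_point_in_set)

lemma D_nonneg: "0 \<le> D"
  using diameter[OF start start] by simp

text \<open>The obtuse-angle property of the projection, with the sign flipped so that step, anchor
  and operator all enter with a plus.\<close>

lemma variational_inequality:
  assumes "y \<in> K"
  shows "(x (Suc k) - x k + \<beta> k *\<^sub>R (x k - x 0) + \<alpha> k *\<^sub>R F (x k)) \<bullet> (y - x (Suc k)) \<ge> 0"
proof -
  have "((1 - \<beta> k) *\<^sub>R x k + \<beta> k *\<^sub>R x 0 - \<alpha> k *\<^sub>R F (x k) - x (Suc k)) \<bullet> (y - x (Suc k)) \<le> 0"
    unfolding step[of k] by (rule closest_point_dot[OF convex closed assms])
  moreover have "(1 - \<beta> k) *\<^sub>R x k + \<beta> k *\<^sub>R x 0 - \<alpha> k *\<^sub>R F (x k) - x (Suc k)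
      = - (x (Suc k) - x k + \<beta> k *\<^sub>R (x k - x 0) + \<alpha> k *\<^sub>R F (x k))"
    by (simp add: algebra_simps)
  ultimately show ?thesis by (metis inner_minus_left neg_le_0_iff_le)
qed

text \<open>Scaling the older of two consecutive variational inequalities by the ratio of the step
  sizes makes the values of \<open>F\<close> enter only through their difference, so no bound on \<open>F\<close> itself
  is needed.\<close>

lemma consecutive_steps:
  assumes "0 \<le> a" "a * \<alpha> k = \<alpha> (Suc k)"
  shows "norm (x (Suc (Suc k)) - x (Suc k)) \<le>
    norm ((a - \<beta> (Suc k)) *\<^sub>R (x (Suc k) - x k) - \<alpha> (Suc k) *\<^sub>R (F (x (Suc k)) - F (x k)))
    + \<bar>a * \<beta> k - \<beta> (Suc k)\<bar> * D"
proof -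
  define u where "u = x (Suc (Suc k)) - x (Suc k)"
  \<comment> \<open>Splitting \<open>x (Suc k) - x 0\<close> at \<open>x k\<close> separates the
    contracting part \<open>v\<close> from the drift \<open>e\<close> caused by the changing anchor
    weight.\<close>
  define v where "v = (a - \<beta> (Suc k)) *\<^sub>R (x (Suc k) - x k) - \<alpha> (Suc k) *\<^sub>R (F (x (Suc k)) - F (x k))"
  define e where "e = (a * \<beta> k - \<beta> (Suc k)) *\<^sub>R (x k - x 0)"
  let ?p = "u + \<beta> (Suc k) *\<^sub>R (x (Suc k) - x 0) + \<alpha> (Suc k) *\<^sub>R F (x (Suc k))"
  let ?q = "x (Suc k) - x k + \<beta> k *\<^sub>R (x k - x 0) + \<alpha> k *\<^sub>R F (x k)"
  \<comment> \<open>The newer inequality is tested at \<open>x (Suc k)\<close> and the older one at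
    \<open>x (Suc (Suc k))\<close>, so both pair with \<open>u\<close> up to sign.\<close>
  have p: "?p \<bullet> u \<le> 0"
    using variational_inequality[OF iterate_in, of "Suc k" "Suc k"]
    unfolding u_def[symmetric]
    by (metis inner_minus_right minus_diff_eq neg_0_le_iff_le u_def)
  have q: "0 \<le> ?q \<bullet> u"
    using variational_inequality[OF iterate_in, of k "Suc (Suc k)"] by (simp add: u_def)
  have "?p - a *\<^sub>R ?q = u - (v + e)"
    unfolding v_def e_def assms(2)[symmetric] by (simp add: algebra_simps)
  then have "(u - (v + e)) \<bullet> u = ?p \<bullet> u - a * (?q \<bullet> u)"
    by (metis inner_diff_left inner_scaleR_left)
  also have "\<dots> \<le> 0"
    using p mult_nonneg_nonneg[OF assms(1) q] by linarith
  finally have "norm u * norm u \<le> (v + e) \<bullet> u"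
    by (simp add: inner_diff_left norm_eq_sqrt_inner)
  also have "\<dots> \<le> norm (v + e) * norm u"
    by (rule norm_cauchy_schwarz)
  finally have "norm u \<le> norm (v + e)"
    by (cases "u = 0") simp_all
  also have "\<dots> \<le> norm v + norm e" by (rule norm_triangle_ineq)
  also have "norm e \<le> \<bar>a * \<beta> k - \<beta> (Suc k)\<bar> * D"
    unfolding e_def using diameter[OF iterate_in start] by (auto intro: mult_left_mono)
  finally show ?thesis by (simp add: u_def v_def)
qed

lemma step_length_le: "norm (x (Suc k) - x k) \<le> 5 * \<gamma> * D / (real k + \<gamma>)"
proof (induction k)
  case 0
  have "norm (x (Suc 0) - x 0) \<le> D" by (intro diameter iterate_in)
  then show ?case using gamma_ge D_nonneg by simp
next
  case (Suc k)
  \<comment> \<open>\<open>n\<close> belongs to the newer step, so the induction hypothesis has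
    denominator \<open>n - 1\<close>.\<close>
  define n where "n = real (Suc k) + \<gamma>"
  define a where "a = sqrt (1 - 1 / n)"
  have n: "3 \<le> n" "\<gamma> + 1 \<le> n" and kn: "real k + \<gamma> = n - 1"
    using gamma_ge by (auto simp: n_def)
  have a: "0 \<le> a" "a\<^sup>2 = 1 - 1 / n"
    using n by (auto simp: a_def)
  have "a = sqrt (n - 1) / sqrt n"
    using n by (simp add: a_def real_sqrt_divide[symmetric] field_simps)
  then have ratio: "a * \<alpha> k = \<alpha> (Suc k)"
    using n L_pos by (simp add: alpha kn n_def[symmetric] del: of_nat_Suc)
  have \<beta>: "\<beta> (Suc k) = \<gamma> / n" "\<beta> k = \<gamma> / (n - 1)"
    by (simp_all add: beta n_def)
  have \<alpha>: "(\<alpha> (Suc k) * L)\<^sup>2 = 1 / n" "0 \<le> \<alpha> (Suc k)"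
    using n L_pos by (simp_all add: alpha n_def[symmetric] power_divide del: of_nat_Suc)
  note contr = contraction_factor_le[OF gamma_ge n(2) a]
  have "norm ((a - \<beta> (Suc k)) *\<^sub>R (x (Suc k) - x k) - \<alpha> (Suc k) *\<^sub>R (F (x (Suc k)) - F (x k)))
      \<le> (1 - 11 / (10 * n)) * norm (x (Suc k) - x k)"
    using contr \<alpha> n by (intro norm_scaled_diff_le[where L = L] monotone lipschitz iterate_in)
      (auto simp: \<beta>)
  also have "\<dots> \<le> (1 - 11 / (10 * n)) * (5 * \<gamma> * D / (n - 1))"
    using Suc n by (intro mult_left_mono) (auto simp: kn)
  finally have main: "norm ((a - \<beta> (Suc k)) *\<^sub>R (x (Suc k) - x k)
      - \<alpha> (Suc k) *\<^sub>R (F (x (Suc k)) - F (x k))) \<le> (1 - 11 / (10 * n)) * (5 * \<gamma> * D / (n - 1))" .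
  have drift: "\<bar>a * \<beta> k - \<beta> (Suc k)\<bar> * D \<le> \<gamma> / (2 * n * (n - 1)) * D"
    using anchor_drift_le[of \<gamma> n a] gamma_ge n a D_nonneg by (intro mult_right_mono) (auto simp: \<beta>)
  have "norm (x (Suc (Suc k)) - x (Suc k))
      \<le> (1 - 11 / (10 * n)) * (5 * \<gamma> * D / (n - 1)) + \<gamma> / (2 * n * (n - 1)) * D"
    using consecutive_steps[OF a(1) ratio] main drift by linarith
  \<comment> \<open>The constant 5 makes this an equality: the excess of 11/10 over 1, times 5, is
    the 1/2 of the drift, and the remaining factor \<open>1 - 1 / n\<close> turns
    \<open>n - 1\<close> into \<open>n\<close>.\<close>
  also have "\<dots> = 5 * \<gamma> * D / n"
    using n by (simp add: divide_simps) (simp add: algebra_simps)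
  finally show ?case by (simp add: n_def)
qed

lemma residual_le:
  "tangential_residual F (normal_cone K) (x (Suc k)) \<le> 11 * \<gamma> * L * D / sqrt (real k + \<gamma>)"
proof -
  define s where "s = sqrt (real k + \<gamma>)"
  define u where "u = x (Suc k) - x k"
  \<comment> \<open>The coefficients are \<open>1 / \<alpha> k\<close> and
    \<open>\<beta> k / \<alpha> k\<close>: \<open>c\<close> is a negative multiple of the vector in
    \<open>variational_inequality\<close>, hence normal at \<open>x (Suc k)\<close>.\<close>
  define c where "c = - ((L * s) *\<^sub>R u + (\<gamma> * L / s) *\<^sub>R (x k - x 0) + F (x k))"
  have s2: "s * s = real k + \<gamma>" using gamma_ge by (simp add: s_def)
  have "1\<^sup>2 \<le> s\<^sup>2" using gamma_ge by (simp add: power2_eq_square s2)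
  then have s: "1 \<le> s" by (rule power2_le_imp_le) (use gamma_ge in \<open>simp add: s_def\<close>)
  have "c = - (L * s) *\<^sub>R (u + \<beta> k *\<^sub>R (x k - x 0) + \<alpha> k *\<^sub>R F (x k))"
  proof -
    have "\<beta> k = \<gamma> / (s * s)" "\<alpha> k = 1 / (L * s)"
      by (simp_all only: beta alpha s2) (simp add: s_def)
    then have "L * s * \<beta> k = \<gamma> * L / s" "L * s * \<alpha> k = 1"
      using s L_pos by simp_all
    then show ?thesis by (simp add: c_def scaleR_add_right)
  qed
  then have "c \<in> normal_cone K (x (Suc k))"
    using variational_inequality[of _ k] s L_pos by (simp add: normal_cone_def u_def)
  then have "tangential_residual F (normal_cone K) (x (Suc k)) \<le> norm (F (x (Suc k)) + c)"
    unfolding tangential_residual_def by (intro cINF_lower bdd_belowI[where m = 0]) auto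
  also have "F (x (Suc k)) + c
      = (F (x (Suc k)) - F (x k)) - (L * s) *\<^sub>R u - (\<gamma> * L / s) *\<^sub>R (x k - x 0)"
    by (simp add: c_def algebra_simps)
  also have "norm \<dots> \<le> norm (F (x (Suc k)) - F (x k)) + norm ((L * s) *\<^sub>R u)
      + norm ((\<gamma> * L / s) *\<^sub>R (x k - x 0))"
    by (meson add_mono norm_triangle_ineq4 order_refl order_trans)
  also have "\<dots> \<le> L * norm u + L * s * norm u + \<gamma> * L / s * D"
    using lipschitz[OF iterate_in iterate_in, of "Suc k" k] diameter[OF iterate_in start, of k]
      s L_pos gamma_ge
    by (intro add_mono) (auto simp: u_def intro!: mult_left_mono divide_right_mono)
  \<comment> \<open>As \<open>s \<ge> 1\<close>, the Lipschitz term is absorbed into the step term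
    at the price of a factor 2.\<close>
  also have "L * norm u \<le> L * s * norm u"
    using s L_pos by (simp add: mult_le_cancel_left1 mult_right_mono)
  also have "L * s * norm u + L * s * norm u + \<gamma> * L / s * D
      = 2 * L * s * norm u + \<gamma> * L / s * D" by simp
  also have "2 * L * s * norm u \<le> 2 * L * s * (5 * \<gamma> * D / (s * s))"
    using step_length_le[of k] s L_pos by (intro mult_left_mono) (auto simp: u_def s2)
  \<comment> \<open>11 is twice the 5 of the step length bound plus 1 from the anchor.\<close>
  also have "2 * L * s * (5 * \<gamma> * D / (s * s)) + \<gamma> * L / s * D = 11 * \<gamma> * L * D / s"
    using s by (simp add: field_simps)
  finally show ?thesis by (simp add: s_def)
qed

end

section \<open>The occupation polytope and its policies\<close>

lemma sum_UNIV_triple: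
  "(\<Sum>i\<in>UNIV. f i) = (\<Sum>t\<in>UNIV. \<Sum>s\<in>UNIV. \<Sum>a\<in>UNIV. f (t, s, a))"
  for f :: "'h::finite \<times> 's::finite \<times> 'a::finite \<Rightarrow> real"
  by (simp add: sum.cartesian_product UNIV_Times_UNIV[symmetric] split_def
      del: UNIV_Times_UNIV)

lemma stageE:
  fixes t :: "'h::finite"
  obtains h where "h < CARD('h)" "t = stage h"
  using bij_betw_stage[where 'h = 'h] by (auto simp: bij_betw_def)

lemma norm_vec_power2: "(norm v)\<^sup>2 = (\<Sum>i\<in>UNIV. (v $ i)\<^sup>2)" for v :: "real ^ 'n::finite"
  by (simp add: norm_vec_def L2_set_def sum_nonneg)

lemma convex_occupation_polytope:
  fixes \<mu>0 :: "'s::finite \<Rightarrow> real" and Q :: "'s \<Rightarrow> 'a::finite \<Rightarrow> 's \<Rightarrow> real"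
  shows "convex (occupation_polytope \<mu>0 Q :: (real ^ ('h::finite \<times> 's \<times> 'a)) set)"
proof (rule convexI)
  fix y z :: "real ^ ('h \<times> 's \<times> 'a)" and u v :: real
  assume *: "y \<in> occupation_polytope \<mu>0 Q" "z \<in> occupation_polytope \<mu>0 Q"
    "0 \<le> u" "0 \<le> v" "u + v = 1"
  \<comment> \<open>Needed for the initial condition, the only inhomogeneous equation of the
    polytope.\<close>
  have "u * p + v * p = p" for p :: real using \<open>u + v = 1\<close> by (metis distrib_right mult_1)
  with * show "u *\<^sub>R y + v *\<^sub>R z \<in> occupation_polytope \<mu>0 Q"
    by (auto simp: occupation_polytope_def sum.distrib distrib_left mult.left_commute
        simp flip: sum_distrib_left)
qed

lemma closed_occupation_polytope: "closed (occupation_polytope \<mu>0 Q)"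
  unfolding occupation_polytope_def
  by (intro closed_Collect_conj closed_Collect_all closed_Collect_imp closed_Collect_le
      closed_Collect_eq open_Collect_const continuous_intros)

lemma occupation_polytope_nonneg: "\<rho> \<in> occupation_polytope \<mu>0 Q \<Longrightarrow> 0 \<le> \<rho> $ i"
  unfolding occupation_polytope_def by blast

lemma marginal_stage_0:
  "\<rho> \<in> occupation_polytope \<mu>0 Q \<Longrightarrow> marginal \<rho> (stage 0) = \<mu>0"
  by (auto simp: occupation_polytope_def marginal_def)

lemma marginal_stage_Suc:
  fixes \<rho> :: "real ^ ('h::finite \<times> 's::finite \<times> 'a::finite)"
  assumes "\<rho> \<in> occupation_polytope \<mu>0 Q" "Suc h < CARD('h)"
  shows "marginal \<rho> (stage (Suc h)) s' = (\<Sum>s\<in>UNIV. \<Sum>a\<in>UNIV. Q s a s' * \<rho> $ (stage h, s, a))"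
  using assms by (auto simp: occupation_polytope_def marginal_def)

text \<open>Mass is conserved from stage to stage because each \<open>Q s a\<close> sums to 1; the
  enumeration of stages then covers every \<open>t\<close>.\<close>

lemma prob_vec_marginal:
  fixes \<rho> :: "real ^ ('h::finite \<times> 's::finite \<times> 'a::finite)"
  assumes \<rho>: "\<rho> \<in> occupation_polytope \<mu>0 Q" and \<mu>0: "prob_vec \<mu>0"
    and Q: "\<And>s a. prob_vec (Q s a)"
  shows "prob_vec (marginal \<rho> t)"
proof -
  have "h < CARD('h) \<Longrightarrow> (\<Sum>s\<in>UNIV. marginal \<rho> (stage h) s) = 1" for h
  proof (induction h)
    case 0
    show ?case using \<mu>0 by (simp add: marginal_stage_0[OF \<rho>] prob_vec_def)
  next
    case (Suc h)
    have "(\<Sum>s'\<in>UNIV. marginal \<rho> (stage (Suc h)) s')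
        = (\<Sum>s'\<in>UNIV. \<Sum>s\<in>UNIV. \<Sum>a\<in>UNIV. Q s a s' * \<rho> $ (stage h, s, a))"
      by (simp add: marginal_stage_Suc[OF \<rho> Suc.prems])
    also have "\<dots> = (\<Sum>s\<in>UNIV. \<Sum>s'\<in>UNIV. \<Sum>a\<in>UNIV. Q s a s' * \<rho> $ (stage h, s, a))"
      by (rule sum.swap)
    also have "\<dots> = (\<Sum>s\<in>UNIV. \<Sum>a\<in>UNIV. \<Sum>s'\<in>UNIV. Q s a s' * \<rho> $ (stage h, s, a))"
      by (intro sum.cong sum.swap refl)
    also have "\<dots> = (\<Sum>s\<in>UNIV. \<Sum>a\<in>UNIV. \<rho> $ (stage h, s, a))"
      using Q by (simp add: prob_vec_def flip: sum_distrib_right)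
    also have "\<dots> = 1"
      using Suc by (simp add: marginal_def)
    finally show ?case .
  qed
  moreover obtain h where "h < CARD('h)" "t = stage h" by (rule stageE)
  moreover have "0 \<le> marginal \<rho> t s" for s
    using \<rho> by (simp add: marginal_def sum_nonneg occupation_polytope_nonneg)
  ultimately show ?thesis by (simp add: prob_vec_def)
qed

text \<open>Where the marginal vanishes the conditional distribution is replaced by the uniform one.\<close>

definition induced_policy ::
  "real ^ ('h::finite \<times> 's::finite \<times> 'a::finite) \<Rightarrow> nat \<Rightarrow> 's \<Rightarrow> 'a \<Rightarrow> real" where
  "induced_policy \<rho> h s a =
     (if marginal \<rho> (stage h) s = 0 then 1 / CARD('a)
      else \<rho> $ (stage h, s, a) / marginal \<rho> (stage h) s)"

lemma policy_flow_induced_policy: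
  assumes "\<And>i. 0 \<le> \<rho> $ i"
  shows "policy_flow H (induced_policy \<rho>)"
proof -
  have "0 \<le> marginal \<rho> t s" for t s
    using assms by (simp add: marginal_def sum_nonneg)
  then have "0 \<le> induced_policy \<rho> h s a" for h s a
    using assms by (simp add: induced_policy_def)
  moreover have "(\<Sum>a\<in>UNIV. induced_policy \<rho> h s a) = 1" for h s
    by (cases "marginal \<rho> (stage h) s = 0")
      (simp_all add: induced_policy_def flip: sum_divide_distrib marginal_def)
  ultimately show ?thesis by (simp add: policy_flow_def prob_vec_def)
qed

text \<open>Where the marginal vanishes, nonnegativity forces every entry of that row to vanish, so
  the uniform default does no harm.\<close>

lemma induced_policy_mult_marginal:
  assumes "\<And>i. 0 \<le> \<rho> $ i"
  shows "induced_policy \<rho> h s a * marginal \<rho> (stage h) s = \<rho> $ (stage h, s, a)"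
proof (cases "marginal \<rho> (stage h) s = 0")
  case True
  then have "\<rho> $ (stage h, s, a) = 0"
    using assms by (simp add: marginal_def sum_nonneg_eq_0_iff)
  with True show ?thesis by simp
qed (simp add: induced_policy_def)

text \<open>With the previous identity, this realises each point of the polytope as the occupation
  flow of a policy.\<close>

lemma state_flow_induced_policy:
  fixes \<rho> :: "real ^ ('h::finite \<times> 's::finite \<times> 'a::finite)"
  assumes \<rho>: "\<rho> \<in> occupation_polytope \<mu>0 Q"
  shows "h < CARD('h) \<Longrightarrow> state_flow \<mu>0 Q (induced_policy \<rho>) h = marginal \<rho> (stage h)"
proof (induction h)
  case 0
  show ?case by (simp add: marginal_stage_0[OF \<rho>])
next
  case (Suc h)
  note eq = induced_policy_mult_marginal[OF occupation_polytope_nonneg[OF \<rho>]]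
  show ?case
    using Suc by (auto simp: marginal_stage_Suc[OF \<rho>] mult.assoc eq)
qed

section \<open>Monotonicity, Lipschitz constant and diameter for the game\<close>

text \<open>Weak monotonicity speaks of policy flows only; induced policies carry it to all of the
  polytope. The minus sign in the operator reverses the inequality.\<close>

lemma reward_operator_monotone:
  fixes x y :: "real ^ ('h::finite \<times> 's::finite \<times> 'a::finite)"
  assumes mono: "weakly_monotone CARD('h) \<mu>0 Q r"
    and x: "x \<in> occupation_polytope \<mu>0 Q" and y: "y \<in> occupation_polytope \<mu>0 Q"
  shows "0 \<le> (reward_operator r x - reward_operator r y) \<bullet> (x - y)"
proof -
  have nn: "0 \<le> x $ i" "0 \<le> y $ i" for i
    using x y by (auto intro: occupation_polytope_nonneg)
  have occ: "occupation_flow \<mu>0 Q (induced_policy z) h s a = z $ (stage h, s, a)"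
    if "z \<in> occupation_polytope \<mu>0 Q" "h < CARD('h)"
    for z :: "real ^ ('h \<times> 's \<times> 'a)" and h s a
    using that by (auto simp: occupation_flow_def state_flow_induced_policy
        induced_policy_mult_marginal occupation_polytope_nonneg)
  have "(reward_operator r x - reward_operator r y) \<bullet> (x - y)
      = (\<Sum>t\<in>UNIV. \<Sum>s\<in>UNIV. \<Sum>a\<in>UNIV.
          - ((r s a (marginal x t) - r s a (marginal y t)) * (x $ (t, s, a) - y $ (t, s, a))))"
    by (simp add: inner_vec_def sum_UNIV_triple reward_operator_def algebra_simps)
  also have "\<dots> = (\<Sum>h<CARD('h). \<Sum>s\<in>UNIV. \<Sum>a\<in>UNIV.
          - ((r s a (marginal x (stage h)) - r s a (marginal y (stage h)))
             * (x $ (stage h, s, a) - y $ (stage h, s, a))))"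
    by (rule sum.reindex_bij_betw[OF bij_betw_stage, symmetric])
  also have "\<dots> = - (\<Sum>h<CARD('h). \<Sum>s\<in>UNIV. \<Sum>a\<in>UNIV.
           (r s a (state_flow \<mu>0 Q (induced_policy x) h)
             - r s a (state_flow \<mu>0 Q (induced_policy y) h)) *
           (occupation_flow \<mu>0 Q (induced_policy x) h s a
             - occupation_flow \<mu>0 Q (induced_policy y) h s a))"
    unfolding sum_negf[symmetric]
    by (intro sum.cong refl) (simp add: state_flow_induced_policy x y occ)
  also have "\<dots> \<ge> 0"
    using mono policy_flow_induced_policy nn unfolding weakly_monotone_def neg_0_le_iff_le by blast
  finally show ?thesis .
qed

text \<open>The square root of |S||A| enters twice: from Cauchy-Schwarz between the total variation
  and Euclidean norms at one stage, and from adding the same squared bound over all pairs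
  \<open>(s, a)\<close>.\<close>

lemma reward_operator_lipschitz:
  fixes x y :: "real ^ ('h::finite \<times> 's::finite \<times> 'a::finite)"
  assumes lip: "lipschitz_reward r Lr" and Lr: "0 \<le> Lr"
    and "\<And>t. prob_vec (marginal x t)" "\<And>t. prob_vec (marginal y t)"
  shows "norm (reward_operator r x - reward_operator r y)
    \<le> real CARD('s) * real CARD('a) * Lr * norm (x - y)"
proof (rule power2_le_imp_le)
  define d where "d = x - y"
  define C where "C = real CARD('s) * real CARD('a)"
  define E where "E t = (\<Sum>s\<in>UNIV. \<Sum>a\<in>UNIV. (d $ (t, s, a))\<^sup>2)" for t
  have tv: "(tv_norm (\<lambda>s. marginal x t s - marginal y t s))\<^sup>2 \<le> C * E t" for t
  proof -
    have "tv_norm (\<lambda>s. marginal x t s - marginal y t s) \<le> (\<Sum>s\<in>UNIV. \<Sum>a\<in>UNIV. \<bar>d $ (t, s, a)\<bar>)"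
      unfolding tv_norm_def marginal_def d_def
      by (intro sum_mono) (simp flip: sum_subtractf)
    also have "\<dots> = (\<Sum>i\<in>UNIV. \<bar>d $ (t, i)\<bar>)"
      by (simp add: sum.cartesian_product)
    finally have "(tv_norm (\<lambda>s. marginal x t s - marginal y t s))\<^sup>2 \<le> (\<Sum>i\<in>UNIV. \<bar>d $ (t, i)\<bar>)\<^sup>2"
      by (intro power_mono) (simp_all add: tv_norm_def sum_nonneg)
    also have "\<dots> \<le> (\<Sum>i\<in>UNIV. (d $ (t, i))\<^sup>2) * real CARD('s \<times> 'a)"
      using Cauchy_Schwarz_ineq_sum[of "\<lambda>i. \<bar>d $ (t, i)\<bar>" "\<lambda>_. 1" "UNIV :: ('s \<times> 'a) set"] by simp
    also have "\<dots> = C * E t"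
      by (simp add: C_def E_def sum.cartesian_product mult_ac)
    finally show ?thesis .
  qed
  have "(r s a (marginal x t) - r s a (marginal y t))\<^sup>2 \<le> Lr\<^sup>2 * (C * E t)" for s a t
  proof -
    have "\<bar>r s a (marginal x t) - r s a (marginal y t)\<bar>
        \<le> Lr * tv_norm (\<lambda>s. marginal x t s - marginal y t s)"
      using lip assms(3,4) unfolding lipschitz_reward_def by blast
    then have "\<bar>r s a (marginal x t) - r s a (marginal y t)\<bar>\<^sup>2
        \<le> (Lr * tv_norm (\<lambda>s. marginal x t s - marginal y t s))\<^sup>2"
      by (intro power_mono) auto
    also have "\<dots> \<le> Lr\<^sup>2 * (C * E t)"
      unfolding power_mult_distrib by (intro mult_left_mono tv) simp
    finally show ?thesis by simp
  qed
  then have "(norm (reward_operator r x - reward_operator r y))\<^sup>2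
      \<le> (\<Sum>t\<in>(UNIV::'h set). \<Sum>s\<in>(UNIV::'s set). \<Sum>a\<in>(UNIV::'a set). Lr\<^sup>2 * (C * E t))"
    unfolding norm_vec_power2 sum_UNIV_triple
    by (intro sum_mono) (simp add: reward_operator_def power2_commute)
  also have "\<dots> = (C * Lr)\<^sup>2 * (\<Sum>t\<in>UNIV. E t)"
    by (simp add: C_def sum_distrib_left sum_distrib_right power2_eq_square mult_ac)
  also have "(\<Sum>t\<in>UNIV. E t) = (norm d)\<^sup>2"
    by (simp add: norm_vec_power2 sum_UNIV_triple E_def)
  finally show "(norm (reward_operator r x - reward_operator r y))\<^sup>2
      \<le> (real CARD('s) * real CARD('a) * Lr * norm (x - y))\<^sup>2"
    by (simp add: d_def C_def power_mult_distrib)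
qed (use Lr in simp)

text \<open>Entries lie in [0,1], so each squared difference is at most the sum of the two entries,
  and every stage has mass 1.\<close>

lemma norm_diff_le_of_marginals:
  fixes x y :: "real ^ ('h::finite \<times> 's::finite \<times> 'a::finite)"
  assumes nn: "\<And>i. 0 \<le> x $ i" "\<And>i. 0 \<le> y $ i"
    and prob: "\<And>t. prob_vec (marginal x t)" "\<And>t. prob_vec (marginal y t)"
  shows "norm (x - y) \<le> sqrt (2 * real CARD('h))"
proof (rule real_le_rsqrt)
  have le1: "z $ (t, s, a) \<le> 1"
    if "\<And>i. 0 \<le> z $ i" "\<And>t. prob_vec (marginal z t)" for z :: "real ^ ('h \<times> 's \<times> 'a)" and t s a
  proof -
    have "z $ (t, s, a) \<le> marginal z t s"
      unfolding marginal_def using that(1) by (intro member_le_sum) auto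
    also have "\<dots> \<le> (\<Sum>s\<in>UNIV. marginal z t s)"
      using that(2) by (intro member_le_sum) (auto simp: prob_vec_def)
    finally show ?thesis using that(2) by (simp add: prob_vec_def)
  qed
  have total: "(\<Sum>i\<in>UNIV. z $ i) = real CARD('h)"
    if "\<And>t. prob_vec (marginal z t)" for z :: "real ^ ('h \<times> 's \<times> 'a)"
    using that by (simp add: sum_UNIV_triple prob_vec_def flip: marginal_def)
  have "(x $ i - y $ i)\<^sup>2 \<le> x $ i + y $ i" for i
  proof -
    obtain t s a where i: "i = (t, s, a)" by (cases i)
    have "x $ i * x $ i \<le> x $ i" "y $ i * y $ i \<le> y $ i"
      using nn le1[of x, OF nn(1) prob(1)] le1[of y, OF nn(2) prob(2)]
      by (auto simp: i mult_left_le)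
    moreover have "0 \<le> x $ i * y $ i" using nn by simp
    ultimately show ?thesis by (simp add: power2_eq_square algebra_simps)
  qed
  then have "(norm (x - y))\<^sup>2 \<le> (\<Sum>i\<in>UNIV. x $ i + y $ i)"
    by (simp add: norm_vec_power2 sum_mono)
  also have "\<dots> = 2 * real CARD('h)"
    using prob by (simp add: sum.distrib total)
  finally show "(norm (x - y))\<^sup>2 \<le> 2 * real CARD('h)" .
qed

theorem theorem4:
  fixes \<mu>0 :: "'s::finite \<Rightarrow> real"
    and P :: "'s \<Rightarrow> 'a::finite \<Rightarrow> ('s \<Rightarrow> real) \<Rightarrow> 's \<Rightarrow> real"
    and Q :: "'s \<Rightarrow> 'a \<Rightarrow> 's \<Rightarrow> real"
    and r :: "'s \<Rightarrow> 'a \<Rightarrow> ('s \<Rightarrow> real) \<Rightarrow> real"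
    and Lr L \<gamma> :: real
    and \<alpha> \<beta> :: "nat \<Rightarrow> real"
    and K :: "(real ^ ('h::finite \<times> 's \<times> 'a)) set"
    and F :: "real ^ ('h \<times> 's \<times> 'a) \<Rightarrow> real ^ ('h \<times> 's \<times> 'a)"
    and \<rho> :: "nat \<Rightarrow> real ^ ('h \<times> 's \<times> 'a)"
    and T :: nat
  assumes "mean_field_game \<mu>0 P"
    and "weakly_monotone CARD('h) \<mu>0 Q r"
    and "measure_independent_kernel P Q"
    and "lipschitz_reward r Lr" and "Lr > 0"
    and "K = occupation_polytope \<mu>0 Q"
    and "F = reward_operator r"
    and "L = real CARD('s) * real CARD('a) * Lr"
    and "\<gamma> \<ge> 2"
    and "\<And>k. \<alpha> k = 1 / (L * sqrt (real k + \<gamma>))"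
    and "\<And>k. \<beta> k = \<gamma> / (real k + \<gamma>)"
    and "\<rho> 0 \<in> K"
    and "\<And>k. \<rho> (Suc k) =
           closest_point K ((1 - \<beta> k) *\<^sub>R \<rho> k + \<beta> k *\<^sub>R \<rho> 0 - \<alpha> k *\<^sub>R F (\<rho> k))"
    and "T \<ge> 1"
  shows "tangential_residual F (normal_cone K) (\<rho> T)
           \<le> 25 * \<gamma> * sqrt (2 * real CARD('h)) * real CARD('s) * real CARD('a) * Lr
               / sqrt (real T - 1 + \<gamma>)"
proof -
  have \<mu>0: "prob_vec \<mu>0" using assms(1) by (simp add: mean_field_game_def)
  \<comment> \<open>\<open>Q\<close> is tied to \<open>P\<close> only at probability vectors;
    \<open>\<mu>0\<close> serves as one.\<close>
  have Q: "prob_vec (Q s a)" for s a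
    using assms(1,3) \<mu>0 by (metis mean_field_game_def measure_independent_kernel_def)
  have nn: "0 \<le> y $ i" and prob: "prob_vec (marginal y t)" if "y \<in> K" for y i t
    using that prob_vec_marginal[OF _ \<mu>0 Q, where ?'h = 'h]
    unfolding assms(6) by (simp_all add: occupation_polytope_nonneg)
  interpret anchored_projection K F L "sqrt (2 * real CARD('h))" \<gamma> \<alpha> \<beta> \<rho>
  proof
    show "convex K" "closed K"
      by (simp_all add: assms(6) convex_occupation_polytope closed_occupation_polytope)
    fix y z assume yz: "y \<in> K" "z \<in> K"
    then show "0 \<le> (F y - F z) \<bullet> (y - z)"
      unfolding assms(6,7) by (rule reward_operator_monotone[OF assms(2)])
    show "norm (F y - F z) \<le> L * norm (y - z)"
      unfolding assms(7,8) using yz assms(4,5) by (intro reward_operator_lipschitz prob) auto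
    show "norm (y - z) \<le> sqrt (2 * real CARD('h))"
      using yz by (intro norm_diff_le_of_marginals nn prob)
  qed (use assms(5,8-13) in auto)
  \<comment> \<open>The residual bound at \<open>\<rho> (Suc k)\<close> carries the index
    \<open>k\<close>, whence \<open>T - 1\<close> under the root.\<close>
  obtain k where T: "T = Suc k" using assms(14) by (cases T) auto
  have "tangential_residual F (normal_cone K) (\<rho> T)
      \<le> 11 * \<gamma> * L * sqrt (2 * real CARD('h)) / sqrt (real k + \<gamma>)"
    unfolding T by (rule residual_le)
  also have "\<dots> \<le> 25 * \<gamma> * L * sqrt (2 * real CARD('h)) / sqrt (real k + \<gamma>)"
    using L_pos gamma_ge by (intro divide_right_mono mult_right_mono) auto
  finally show ?thesis by (simp add: T assms(8) mult_ac)
qed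

end
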